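(* Let $H_{\rm WR}$ be the path on three vertices with a loop at each vertex (the Widom-Rowlinson graph). Then for every loop-free $d$-regular graph $G$ on $n$ vertices, $$\hom(G,H_{\rm WR}) \leq \hom(K_{d+1},H_{\rm WR})^{\frac{n}{d+1}}.$$
   Context: All graphs are finite and undirected, without multiple edges, but may have loops unless stated otherwise. A homomorphism from $G$ to $H$ is a map $\phi:V(G)\to V(H)$ such that $\phi(u)\phi(v)\in E(H)$ for every edge (including loops) $uv\in E(G)$; $\hom(G,H)$ is the number of homomorphisms from $G$ to $H$. $K_{d+1}$ is the complete loop-free graph on $d+1$ vertices. Explicitly, $H_{\rm WR}$ has vertices $1,2,3$ and edges $11,22,33,12,23$. *)

theory Defs
  imports Complex_Main "HOL-Library.FuncSet" "Graph_Theory.Graph_Theory"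
begin

text \<open>
  A finite undirected graph without multiple edges, possibly with loops, is a
  \<^locale>\<open>pair_pseudo_graph\<close>: an edge \<open>uv\<close> is represented by the two arcs \<open>(u, v)\<close> and
  \<open>(v, u)\<close>, a loop at \<open>u\<close> by the single arc \<open>(u, u)\<close>. Such a graph is loop-free iff it is a
  \<^locale>\<open>pair_graph\<close>.
\<close>

text \<open>
  Homomorphisms are taken in the extensional function space, so that maps differing only outside
  the vertex set are not counted separately.
\<close>

definition homs :: "'a pair_pre_digraph \<Rightarrow> 'b pair_pre_digraph \<Rightarrow> ('a \<Rightarrow> 'b) set" where
  "homs G H = {\<phi> \<in> pverts G \<rightarrow>\<^sub>E pverts H. \<forall>(u, v) \<in> parcs G. (\<phi> u, \<phi> v) \<in> parcs H}"

definition hom_count :: "'a pair_pre_digraph \<Rightarrow> 'b pair_pre_digraph \<Rightarrow> nat" where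
  "hom_count G H = card (homs G H)"

text \<open>
  In a loop-free symmetric digraph the out-degree of a vertex is its number of neighbours.
\<close>

definition regular :: "nat \<Rightarrow> 'a pair_pre_digraph \<Rightarrow> bool" where
  "regular d G \<longleftrightarrow> (\<forall>v \<in> pverts G. out_degree (with_proj G) v = d)"

definition complete_graph :: "nat \<Rightarrow> nat pair_pre_digraph" where
  "complete_graph m =
    \<lparr> pverts = {..<m}, parcs = {(u, v). u < m \<and> v < m \<and> u \<noteq> v} \<rparr>"

definition H_WR :: "nat pair_pre_digraph" where
  "H_WR = \<lparr> pverts = {1, 2, 3},
            parcs = {(1, 1), (2, 2), (3, 3), (1, 2), (2, 1), (2, 3), (3, 2)} \<rparr>"

lemma complete_digraph_complete_graph: "K\<^bsub>m\<^esub> (with_proj (complete_graph m))"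
  unfolding complete_digraph_pair_def by (auto simp: complete_graph_def)

lemma pair_pseudo_graph_H_WR: "pair_pseudo_graph H_WR"
  by unfold_locales (auto simp: H_WR_def symmetric_def sym_def arcs_ends_conv)

lemma finite_homs:
  assumes "finite (pverts G)" "finite (pverts H)"
  shows "finite (homs G H)"
  using assms by (simp add: homs_def finite_PiE)

end

theory Submission
  imports Defs
begin

text \<open>
  A homomorphism to the Widom-Rowlinson graph is a pair of disjoint vertex sets, the fibres \<open>S\<close> of
  1 and \<open>T\<close> of 3, with no edge between them. Once \<open>S\<close> is chosen, \<open>T\<close> is an arbitrary set of
  vertices whose closed neighbourhood misses \<open>S\<close>, so the number of homomorphisms is the sum over
  \<open>S\<close> of a product of local weights, one for each vertex \<open>v\<close>: the weight is 2 if \<open>S\<close> misses \<open>N[v]\<close>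
  and 1 otherwise. As every vertex lies in exactly \<open>d + 1\<close> closed neighbourhoods, Finner's
  generalisation of Hoelder's inequality bounds the sum by a product of \<open>(d + 1)\<close>-st roots of
  sums over the subsets of single neighbourhoods, each of which counts the homomorphisms from the
  complete graph on \<open>d + 1\<close> vertices.
\<close>

section \<open>AM-GM and Hoelder's inequality for two summands\<close>

lemma prod_le_mean_power:
  fixes a :: "'i \<Rightarrow> real"
  assumes "finite J" and a: "\<And>i. i \<in> J \<Longrightarrow> 0 \<le> a i"
  shows "(\<Prod>i\<in>J. a i) \<le> ((\<Sum>i\<in>J. a i) / card J) ^ card J"
proof (cases "(\<Sum>i\<in>J. a i) = 0")
  case True
  then have "\<forall>i\<in>J. a i = 0" using assms by (simp add: sum_nonneg_eq_0_iff)
  then show ?thesis using True by (cases "J = {}") (auto simp: assms(1) card_gt_0_iff)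
next
  case False
  then have "J \<noteq> {}" by auto
  then have card_pos: "0 < card J" using assms(1) by (simp add: card_gt_0_iff)
  define m where "m = (\<Sum>i\<in>J. a i) / card J"
  have "0 \<le> (\<Sum>i\<in>J. a i)" using a by (rule sum_nonneg)
  then have m: "0 < m" using False card_pos by (simp add: m_def)
  \<comment> \<open>Each factor is bounded by \<open>1 + t \<le> exp t\<close> with
    \<open>t = a i / m - 1\<close>; these exponents sum to 0 because \<open>m\<close> is the
    mean.\<close>
  have "(\<Prod>i\<in>J. a i / m) \<le> (\<Prod>i\<in>J. exp (a i / m - 1))"
    using a m exp_ge_add_one_self[of "a _ / m - 1"] by (intro prod_mono) auto
  also have "\<dots> = exp ((\<Sum>i\<in>J. a i) / m - card J)"
    using assms(1) by (simp add: sum_subtractf sum_divide_distrib flip: exp_sum)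
  also have "\<dots> = 1" using False card_pos by (simp add: m_def)
  finally show ?thesis using m by (simp add: prod_dividef divide_le_eq flip: m_def)
qed

text \<open>Hoelder's inequality with \<open>card J\<close> equal exponents: after dividing each
  pair \<open>(x i, y i)\<close> by its norm \<open>r i\<close>, AM-GM bounds both products by means
  of powers that add up to 1 for each \<open>i\<close>.\<close>

lemma prod_add_prod_le_prod_root:
  fixes x y :: "'i \<Rightarrow> real"
  assumes "finite J" "J \<noteq> {}"
    and x: "\<And>i. i \<in> J \<Longrightarrow> 0 \<le> x i" and y: "\<And>i. i \<in> J \<Longrightarrow> 0 \<le> y i"
  shows "(\<Prod>i\<in>J. x i) + (\<Prod>i\<in>J. y i) \<le> (\<Prod>i\<in>J. root (card J) (x i ^ card J + y i ^ card J))"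
proof -
  define D where "D = card J"
  have D: "0 < D" using assms by (simp add: D_def card_gt_0_iff)
  define r where "r i = root D (x i ^ D + y i ^ D)" for i
  have r_nonneg: "0 \<le> r i" if "i \<in> J" for i
    using x[OF that] y[OF that] D by (simp add: r_def)
  have r_pow: "r i ^ D = x i ^ D + y i ^ D" if "i \<in> J" for i
    using x[OF that] y[OF that] D by (simp add: r_def)
  show ?thesis
  \<comment> \<open>A vanishing norm forbids the division, but then both products on the left are
    0.\<close>
  proof (cases "\<exists>i\<in>J. r i = 0")
    case True
    then obtain i where i: "i \<in> J" "r i = 0" by blast
    with r_pow[of i] D have "x i ^ D + y i ^ D = 0" by (simp add: zero_power)
    then have "x i = 0" "y i = 0"
      using x[OF i(1)] y[OF i(1)] D by (auto simp: add_nonneg_eq_0_iff)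
    then have "(\<Prod>i\<in>J. x i) = 0" "(\<Prod>i\<in>J. y i) = 0"
      using i(1) \<open>finite J\<close> by (auto intro: prod_zero)
    moreover have "0 \<le> (\<Prod>i\<in>J. r i)" by (simp add: prod_nonneg r_nonneg)
    ultimately show ?thesis by (simp add: r_def D_def)
  next
    case False
    then have r_pos: "0 < r i" if "i \<in> J" for i
      using r_nonneg[OF that] that by force
    have amgm: "(\<Prod>i\<in>J. z i / r i) \<le> (\<Sum>i\<in>J. (z i / r i) ^ D) / D"
      if z: "\<And>i. i \<in> J \<Longrightarrow> 0 \<le> z i" for z
    proof -
      have "(\<Prod>i\<in>J. z i / r i) ^ D \<le> ((\<Sum>i\<in>J. (z i / r i) ^ D) / D) ^ D"
        using prod_le_mean_power[OF assms(1), of "\<lambda>i. (z i / r i) ^ D"] z r_nonneg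
        by (simp add: D_def prod_power_distrib)
      moreover have "0 \<le> (\<Sum>i\<in>J. (z i / r i) ^ D) / D"
        using z r_nonneg by (simp add: sum_nonneg)
      ultimately show ?thesis using D by (simp add: power_mono_iff prod_nonneg z r_nonneg)
    qed
    have one: "(x i / r i) ^ D + (y i / r i) ^ D = 1" if "i \<in> J" for i
      using r_pow[OF that] r_pos[OF that]
      by (metis add_divide_distrib divide_self less_irrefl power_divide zero_less_power)
    have "(\<Prod>i\<in>J. x i / r i) + (\<Prod>i\<in>J. y i / r i)
        \<le> (\<Sum>i\<in>J. (x i / r i) ^ D + (y i / r i) ^ D) / D"
      using amgm[of x] amgm[of y] x y by (simp add: sum.distrib add_divide_distrib)
    also have "\<dots> = 1"
      using D by (simp add: one) (simp add: D_def)
    finally have "((\<Prod>i\<in>J. x i) + (\<Prod>i\<in>J. y i)) / (\<Prod>i\<in>J. r i) \<le> 1"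
      by (simp add: prod_dividef add_divide_distrib)
    moreover have "0 < (\<Prod>i\<in>J. r i)" by (simp add: prod_pos r_pos)
    ultimately show ?thesis by (simp add: r_def D_def divide_le_eq)
  qed
qed

section \<open>Finner's inequality over the subsets of a finite set\<close>

lemma sum_Pow_insert:
  assumes "finite A" "a \<notin> A"
  shows "(\<Sum>S\<in>Pow (insert a A). h S) = (\<Sum>S\<in>Pow A. h S + h (insert a S))"
proof -
  have "inj_on (insert a) (Pow A)" using assms(2) by (auto simp: inj_on_def)
  moreover have "Pow A \<inter> insert a ` Pow A = {}" using assms(2) by auto
  ultimately show ?thesis
    using assms(1) by (simp add: Pow_insert sum.union_disjoint sum.reindex sum.distrib)
qed

text \<open>Induction on \<open>A\<close> sums out one element \<open>a\<close> at a time: Hoelder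
  merges the \<open>D\<close> factors that depend on \<open>a\<close> into new functions. Hence
  \<open>f\<close> has to vary in the induction.\<close>

lemma finner_inequality_Pow:
  fixes f :: "'i \<Rightarrow> 'a set \<Rightarrow> real"
  assumes "finite A" "finite I" "0 < D"
    and "\<And>a. a \<in> A \<Longrightarrow> card {i \<in> I. a \<in> N i} = D"
    and "\<And>i S. i \<in> I \<Longrightarrow> 0 \<le> f i S"
  shows "(\<Sum>S\<in>Pow A. \<Prod>i\<in>I. f i (S \<inter> N i))
    \<le> (\<Prod>i\<in>I. root D (\<Sum>T\<in>Pow (A \<inter> N i). f i T ^ D))"
  using assms(1,4,5)
proof (induction A arbitrary: f rule: finite_induct)
  case empty
  then show ?case using \<open>0 < D\<close> by (simp add: real_root_power_cancel)
next
  case (insert a A)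
  define J where "J = {i \<in> I. a \<in> N i}"
  have J: "J \<subseteq> I" "finite J" "card J = D" "J \<noteq> {}"
    using insert.prems(1)[of a] \<open>finite I\<close> \<open>0 < D\<close> by (auto simp: J_def card_gt_0_iff)
  \<comment> \<open>\<open>g i\<close> is the \<open>D\<close>-norm of \<open>f i\<close> in the
    coordinate \<open>a\<close>; factors that do not see \<open>a\<close> stay unchanged.\<close>
  define g where "g i T = (if i \<in> J then root D (f i T ^ D + f i (insert a T) ^ D) else f i T)"
    for i T
  have g_nonneg: "0 \<le> g i T" if "i \<in> I" for i T
    using insert.prems(2)[OF that] \<open>0 < D\<close> by (simp add: g_def)
  have split_I: "(\<Prod>i\<in>I. h i) = (\<Prod>i\<in>J. h i) * (\<Prod>i\<in>I - J. h i)" for h :: "'i \<Rightarrow> real"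
    using prod.subset_diff[OF J(1) \<open>finite I\<close>, of h] by (simp add: mult.commute)
  have hoelder: "(\<Prod>i\<in>I. f i (S \<inter> N i)) + (\<Prod>i\<in>I. f i (insert a S \<inter> N i))
      \<le> (\<Prod>i\<in>I. g i (S \<inter> N i))" if "S \<subseteq> A" for S
  proof -
    have "(\<Prod>i\<in>I. f i (insert a S \<inter> N i))
        = (\<Prod>i\<in>J. f i (insert a (S \<inter> N i))) * (\<Prod>i\<in>I - J. f i (S \<inter> N i))"
      unfolding split_I by (intro arg_cong2[of _ _ _ _ "(*)"] prod.cong) (auto simp: J_def)
    then have "(\<Prod>i\<in>I. f i (S \<inter> N i)) + (\<Prod>i\<in>I. f i (insert a S \<inter> N i))
        = ((\<Prod>i\<in>J. f i (S \<inter> N i)) + (\<Prod>i\<in>J. f i (insert a (S \<inter> N i))))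
          * (\<Prod>i\<in>I - J. f i (S \<inter> N i))"
      by (simp add: split_I[of "\<lambda>i. f i (S \<inter> N i)"] distrib_right)
    \<comment> \<open>Hoelder's exponent is \<open>card J\<close>, which equals \<open>D\<close>
      since \<open>a\<close> is covered exactly \<open>D\<close> times.\<close>
    also have "\<dots> \<le> (\<Prod>i\<in>J. g i (S \<inter> N i)) * (\<Prod>i\<in>I - J. f i (S \<inter> N i))"
    proof (intro mult_right_mono)
      show "(\<Prod>i\<in>J. f i (S \<inter> N i)) + (\<Prod>i\<in>J. f i (insert a (S \<inter> N i)))
          \<le> (\<Prod>i\<in>J. g i (S \<inter> N i))"
        using prod_add_prod_le_prod_root[OF J(2,4), of "\<lambda>i. f i (S \<inter> N i)"
            "\<lambda>i. f i (insert a (S \<inter> N i))"] insert.prems(2) J(1)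
        by (auto simp: g_def J(3) cong: prod.cong)
    qed (auto intro: prod_nonneg insert.prems(2))
    also have "\<dots> = (\<Prod>i\<in>I. g i (S \<inter> N i))"
      unfolding split_I by (simp add: g_def)
    finally show ?thesis .
  qed
  \<comment> \<open>Passing from \<open>f\<close> to \<open>g\<close> preserves the power sums, so
    the bound from the induction hypothesis is already the required one.\<close>
  have marginal: "(\<Sum>T\<in>Pow (A \<inter> N i). g i T ^ D) = (\<Sum>T\<in>Pow (insert a A \<inter> N i). f i T ^ D)"
    if "i \<in> I" for i
  proof (cases "i \<in> J")
    case True
    then have "insert a A \<inter> N i = insert a (A \<inter> N i)" by (auto simp: J_def)
    moreover have "g i T ^ D = f i T ^ D + f i (insert a T) ^ D" for T
      using True insert.prems(2)[OF that] \<open>0 < D\<close> by (simp add: g_def)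
    ultimately show ?thesis
      using insert.hyps by (simp add: sum_Pow_insert)
  next
    case False
    then have "insert a A \<inter> N i = A \<inter> N i" using that by (auto simp: J_def)
    then show ?thesis using False by (simp add: g_def)
  qed
  have "(\<Sum>S\<in>Pow (insert a A). \<Prod>i\<in>I. f i (S \<inter> N i)) \<le> (\<Sum>S\<in>Pow A. \<Prod>i\<in>I. g i (S \<inter> N i))"
    unfolding sum_Pow_insert[OF insert.hyps] by (intro sum_mono hoelder) auto
  also have "\<dots> \<le> (\<Prod>i\<in>I. root D (\<Sum>T\<in>Pow (A \<inter> N i). g i T ^ D))"
    by (intro insert.IH insert.prems(1) g_nonneg) auto
  also have "\<dots> = (\<Prod>i\<in>I. root D (\<Sum>T\<in>Pow (insert a A \<inter> N i). f i T ^ D))"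
    by (intro prod.cong refl arg_cong[of _ _ "root D"] marginal)
  finally show ?case .
qed

section \<open>Closed neighbourhoods\<close>

definition closed_nbhd :: "'a pair_pre_digraph \<Rightarrow> 'a \<Rightarrow> 'a set" where
  "closed_nbhd G v = insert v {u. (v, u) \<in> parcs G}"

lemma closed_nbhd_subset:
  assumes "pair_graph G" "v \<in> pverts G"
  shows "closed_nbhd G v \<subseteq> pverts G"
proof -
  interpret pair_graph G by fact
  show ?thesis using assms(2) in_arcsD1 in_arcsD2 by (auto simp: closed_nbhd_def)
qed

lemma closed_nbhd_sym:
  assumes "pair_graph G"
  shows "u \<in> closed_nbhd G v \<longleftrightarrow> v \<in> closed_nbhd G u"
proof -
  interpret pair_graph G by fact
  show ?thesis using arcs_symmetric by (auto simp: closed_nbhd_def)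
qed

lemma card_closed_nbhd:
  assumes "pair_graph G" "regular d G" "v \<in> pverts G"
  shows "card (closed_nbhd G v) = d + 1"
proof -
  interpret pair_graph G by fact
  have "out_arcs (with_proj G) v = Pair v ` {u. (v, u) \<in> parcs G}"
    by (auto simp: out_arcs_def)
  then have "card {u. (v, u) \<in> parcs G} = out_degree (with_proj G) v"
    by (simp add: out_degree_def card_image inj_on_def)
  moreover have "finite {u. (v, u) \<in> parcs G}"
    by (rule finite_subset[OF _ finite_verts]) (use in_arcsD1 in_arcsD2 in auto)
  \<comment> \<open>Without a loop, \<open>v\<close> is not among its \<open>d\<close> neighbours,
    whence the \<open>+ 1\<close>.\<close>
  moreover have "(v, v) \<notin> parcs G" using no_loops' by auto
  ultimately show ?thesis
    using assms(2,3) by (simp add: closed_nbhd_def regular_def)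
qed

section \<open>Counting homomorphisms to the Widom-Rowlinson graph\<close>

lemma hom_count_H_WR_eq_sum:
  assumes "pair_graph G"
  shows "hom_count G H_WR
    = (\<Sum>S\<in>Pow (pverts G). 2 ^ card {v \<in> pverts G. S \<inter> closed_nbhd G v = {}})"
proof -
  interpret pair_graph G by fact
  define V where "V = pverts G"
  have fin: "finite V" by (simp add: V_def)
  \<comment> \<open>The vertices still allowed to take the value 3; as \<open>v\<close> lies in its
    own closed neighbourhood, \<open>M S\<close> is also disjoint from \<open>S\<close>.\<close>
  define M where "M S = {v \<in> V. S \<inter> closed_nbhd G v = {}}" for S
  define fibers where "fibers \<phi> = ({v \<in> V. \<phi> v = (1::nat)}, {v \<in> V. \<phi> v = 3})" for \<phi>
  \<comment> \<open>The inverse of \<open>fibers\<close>; the default 2 is safe, being adjacent to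
    every vertex of \<open>H_WR\<close>.\<close>
  define colour where
    "colour p = (\<lambda>v\<in>V. if v \<in> fst p then 1 else if v \<in> snd p then 3 else (2::nat))" for p
  have "bij_betw fibers (homs G H_WR) (Sigma (Pow V) (\<lambda>S. Pow (M S)))"
  proof (rule bij_betw_byWitness[where f' = colour])
    show "\<forall>\<phi>\<in>homs G H_WR. colour (fibers \<phi>) = \<phi>"
      by (auto simp: colour_def fibers_def homs_def H_WR_def V_def fun_eq_iff PiE_def Pi_def
          extensional_def)
    show "\<forall>p\<in>Sigma (Pow V) (\<lambda>S. Pow (M S)). fibers (colour p) = p"
      by (auto simp: colour_def fibers_def M_def closed_nbhd_def)
    show "fibers ` homs G H_WR \<subseteq> Sigma (Pow V) (\<lambda>S. Pow (M S))"
      by (fastforce simp: fibers_def homs_def H_WR_def M_def closed_nbhd_def)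
    show "colour ` Sigma (Pow V) (\<lambda>S. Pow (M S)) \<subseteq> homs G H_WR"
    proof safe
      fix S T assume ST: "S \<subseteq> V" "T \<subseteq> M S"
      have "(colour (S, T) u, colour (S, T) v) \<in> parcs H_WR" if "(u, v) \<in> parcs G" for u v
      proof -
        \<comment> \<open>\<open>M S\<close> only restricts arcs leaving \<open>T\<close>; an arc
          from \<open>S\<close> to \<open>T\<close> is excluded through its reverse.\<close>
        have "u \<in> V" "v \<in> V" "(v, u) \<in> parcs G"
          using that in_arcsD1 in_arcsD2 arcs_symmetric by (auto simp: V_def)
        then show ?thesis
          using ST that by (auto simp: colour_def H_WR_def M_def closed_nbhd_def)
      qed
      then show "colour (S, T) \<in> homs G H_WR"
        by (auto simp: homs_def) (auto simp: colour_def H_WR_def V_def)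
    qed
  qed
  then have "hom_count G H_WR = card (Sigma (Pow V) (\<lambda>S. Pow (M S)))"
    by (simp add: hom_count_def bij_betw_same_card)
  also have "\<dots> = (\<Sum>S\<in>Pow V. card (Pow (M S)))"
    using fin by (intro card_SigmaI) (auto simp: M_def)
  also have "\<dots> = (\<Sum>S\<in>Pow V. 2 ^ card (M S))"
    using fin by (simp add: card_Pow M_def)
  finally show ?thesis by (simp add: V_def M_def)
qed

text \<open>Evaluates both the count for the complete graph and, with \<open>c = 2 ^ D\<close>, each
  local factor of Finner's bound.\<close>

lemma sum_Pow_weight_empty:
  assumes "finite A"
  shows "(\<Sum>T\<in>Pow A. if T = {} then c else (1::real)) = c + (2 ^ card A - 1)"
proof -
  have "(\<Sum>T\<in>Pow A. if T = {} then c else (1::real)) = c + (\<Sum>T\<in>Pow A - {{}}. 1)"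
    using assms by (subst sum.remove[where x = "{}"]) auto
  then show ?thesis
    using assms by (simp add: card_Pow of_nat_diff)
qed

text \<open>Every closed neighbourhood is the whole vertex set, so only \<open>S = {}\<close> leaves
  any choice for the fibre of 3.\<close>

lemma hom_count_complete_graph_H_WR:
  "real (hom_count (complete_graph m) H_WR) = 2 ^ m + (2 ^ m - 1)"
proof -
  have "pair_graph (complete_graph m)"
    by unfold_locales (auto simp: complete_graph_def symmetric_def sym_def arcs_ends_conv
        intro: finite_subset[of _ "{..<m} \<times> {..<m}"])
  note count = hom_count_H_WR_eq_sum[OF this]
  have nbhd: "closed_nbhd (complete_graph m) v = {..<m}" if "v < m" for v
    using that by (auto simp: closed_nbhd_def complete_graph_def)
  have "{v. v < m \<and> S \<inter> closed_nbhd (complete_graph m) v = {}} = (if S = {} then {..<m} else {})"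
    if "S \<subseteq> {..<m}" for S
    using that by (auto simp: nbhd)
  then have "real (hom_count (complete_graph m) H_WR)
      = (\<Sum>S\<in>Pow {..<m}. if S = {} then 2 ^ m else 1)"
    unfolding count of_nat_sum by (intro sum.cong) (auto simp: complete_graph_def)
  then show ?thesis by (simp add: sum_Pow_weight_empty)
qed

theorem mainTheorem3:
  fixes G :: "'a pair_pre_digraph" and d n :: nat
  assumes "pair_graph G"
    and "regular d G"
    and "card (pverts G) = n"
  shows "real (hom_count G H_WR)
    \<le> real (hom_count (complete_graph (d + 1)) H_WR) powr (real n / real (d + 1))"
proof -
  interpret pair_graph G by fact
  define V where "V = pverts G"
  define N where "N = closed_nbhd G"
  define D where "D = d + 1"
  define f where "f v T = (if T = {} then 2 else (1::real))" for v :: 'a and T :: "'a set"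
  define K where "K = real (hom_count (complete_graph D) H_WR)"
  have fin: "finite V" by (simp add: V_def)
  have N: "N v \<subseteq> V" "card (N v) = D" "finite (N v)" if "v \<in> V" for v
    using closed_nbhd_subset[OF assms(1)] card_closed_nbhd[OF assms(1,2)] that
      finite_subset[OF _ fin] by (auto simp: V_def N_def D_def)
  have K: "K = 2 ^ D + (2 ^ D - 1)" by (simp add: K_def hom_count_complete_graph_H_WR)
  moreover have "(1::real) \<le> 2 ^ D" by simp
  ultimately have "0 < K" by linarith
  have "real (hom_count G H_WR) = (\<Sum>S\<in>Pow V. 2 ^ card {v \<in> V. S \<inter> N v = {}})"
    by (simp add: hom_count_H_WR_eq_sum[OF assms(1)] V_def N_def)
  also have "\<dots> = (\<Sum>S\<in>Pow V. \<Prod>v\<in>V. f v (S \<inter> N v))"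
    using fin by (simp add: f_def prod.If_cases Collect_conj_eq)
  also have "\<dots> \<le> (\<Prod>v\<in>V. root D (\<Sum>T\<in>Pow (V \<inter> N v). f v T ^ D))"
  proof (rule finner_inequality_Pow)
    fix a assume "a \<in> V"
    \<comment> \<open>By symmetry of adjacency, the neighbourhoods covering \<open>a\<close> are
      indexed by \<open>N a\<close>.\<close>
    then have "{v \<in> V. a \<in> N v} = N a"
      using N(1) closed_nbhd_sym[OF assms(1)] by (auto simp: N_def)
    then show "card {v \<in> V. a \<in> N v} = D" using N(2) \<open>a \<in> V\<close> by simp
  qed (use fin in \<open>auto simp: D_def f_def\<close>)
  also have "\<dots> = (\<Prod>v\<in>V. root D K)"
  proof (intro prod.cong refl arg_cong[of _ _ "root D"])
    fix v assume v: "v \<in> V"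
    \<comment> \<open>The \<open>D\<close>-th power turns the weight 2 into \<open>2 ^ D\<close>,
      the weight of the empty set in the count for the complete graph.\<close>
    have "f v T ^ D = (if T = {} then 2 ^ D else 1)" for T by (simp add: f_def)
    moreover have "V \<inter> N v = N v" using N(1)[OF v] by auto
    ultimately show "(\<Sum>T\<in>Pow (V \<inter> N v). f v T ^ D) = K"
      using N(2,3)[OF v] by (simp add: sum_Pow_weight_empty K)
  qed
  also have "\<dots> = K powr (n / D)"
    using \<open>0 < K\<close> assms(3)
    by (simp add: V_def D_def root_powr_inverse powr_powr flip: powr_realpow)
  finally show ?thesis by (simp add: K_def D_def)
qed

end
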